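(* Let $G$ be a $2$-edge-connected graph, let $C\in\mathrm{CP}(G)$, and let $G_1,\dots,G_r$ be the connected components of $G-C$ that contain at least one edge. Let $f\in C$ and $e_j\in E(G_j)$ for $j\in[r]$. Then the coparallel class inequality $$\sum_{j=1}^r x_{e_j}-(r-1)x_f\le 1$$ defines a facet of $\mathrm{TECSP}(G)$.
   Context: All graphs are finite, simple and undirected. For $\emptyset\subsetneq S\subsetneq V(G)$, $\delta(S)$ is the set of edges with exactly one endpoint in $S$ (a cut). An edge $e$ is a bridge if $\{e\}=\delta(S)$ for some $S$. A graph is $2$-edge-connected if it is connected and has no bridges; the empty graph and a single vertex are $2$-edge-connected. $\chi^H\in\{0,1\}^{E(G)}$ is the incidence vector of $E(H)$, and $\mathrm{TECSP}(G)=\mathrm{conv}\{\chi^H : H\subseteq G\text{ is }2\text{-edge-connected}\}\subseteq\mathbb{R}^{E(G)}$. Two distinct edges $e,f$ are coparallel if $\{e,f\}$ is an inclusion-wise minimal cut. A coparallel class is an inclusion-wise maximal set of non-bridge edges any two distinct elements of which are coparallel (a non-bridge edge in no $2$-cut forms a singleton class). $\mathrm{CP}(G)$ is the set of coparallel classes of $G$. $G-C$ denotes $G$ with the edges of $C$ deleted (all vertices kept). A facet is a face of dimension $\dim(\mathrm{TECSP}(G))-1$. *)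

theory Defs
  imports "HOL-Analysis.Analysis"
begin

text \<open>A finite simple graph G is given by a finite vertex set V and an edge type 'e
  (a finite type, so that E(G) = UNIV and R^E(G) = real^'e); each edge e has a set
  of endpoints ends e, a 2-element subset of V, and ends is injective (no parallel edges).
  General (sub)graphs are pairs (W, F) with W a vertex set and F an edge set.\<close>

definition simple_graph :: "'v set \<Rightarrow> ('e \<Rightarrow> 'v set) \<Rightarrow> bool" where
  "simple_graph V ends \<longleftrightarrow> finite V \<and> inj ends \<and> (\<forall>e. ends e \<subseteq> V \<and> card (ends e) = 2)"

definition is_subgraph :: "'v set \<Rightarrow> ('e \<Rightarrow> 'v set) \<Rightarrow> 'v set \<Rightarrow> 'e set \<Rightarrow> bool" where
  "is_subgraph V ends W F \<longleftrightarrow> W \<subseteq> V \<and> (\<forall>e\<in>F. ends e \<subseteq> W)"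

text \<open>delta(S): edges of F with exactly one endpoint in S.\<close>
definition delta :: "('e \<Rightarrow> 'v set) \<Rightarrow> 'e set \<Rightarrow> 'v set \<Rightarrow> 'e set" where
  "delta ends F S = {e\<in>F. card (ends e \<inter> S) = 1}"

definition is_cut :: "('e \<Rightarrow> 'v set) \<Rightarrow> 'v set \<Rightarrow> 'e set \<Rightarrow> 'e set \<Rightarrow> bool" where
  "is_cut ends W F D \<longleftrightarrow> (\<exists>S. {} \<subset> S \<and> S \<subset> W \<and> D = delta ends F S)"

definition is_bridge :: "('e \<Rightarrow> 'v set) \<Rightarrow> 'v set \<Rightarrow> 'e set \<Rightarrow> 'e \<Rightarrow> bool" where
  "is_bridge ends W F e \<longleftrightarrow> is_cut ends W F {e}"

definition adj :: "('e \<Rightarrow> 'v set) \<Rightarrow> 'e set \<Rightarrow> ('v \<times> 'v) set" where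
  "adj ends F = {(u, v). \<exists>e\<in>F. ends e = {u, v}}"

definition connected_graph :: "('e \<Rightarrow> 'v set) \<Rightarrow> 'v set \<Rightarrow> 'e set \<Rightarrow> bool" where
  "connected_graph ends W F \<longleftrightarrow> (\<forall>u\<in>W. \<forall>v\<in>W. (u, v) \<in> (adj ends F)\<^sup>*)"

text \<open>2-edge-connected: connected and no bridges (empty graph / single vertex included).\<close>
definition two_edge_connected :: "('e \<Rightarrow> 'v set) \<Rightarrow> 'v set \<Rightarrow> 'e set \<Rightarrow> bool" where
  "two_edge_connected ends W F \<longleftrightarrow>
     connected_graph ends W F \<and> (\<forall>e\<in>F. \<not> is_bridge ends W F e)"

definition incidence_vec :: "'e set \<Rightarrow> real ^ ('e::finite)" where
  "incidence_vec F = (\<chi> i. if i \<in> F then 1 else 0)"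

definition TECSP :: "'v set \<Rightarrow> ('e::finite \<Rightarrow> 'v set) \<Rightarrow> (real ^ 'e) set" where
  "TECSP V ends = convex hull {incidence_vec F | W F.
       is_subgraph V ends W F \<and> two_edge_connected ends W F}"

text \<open>e, f coparallel in G = (V, UNIV): distinct and {e,f} an inclusion-wise minimal cut.\<close>
definition coparallel :: "'v set \<Rightarrow> ('e \<Rightarrow> 'v set) \<Rightarrow> 'e \<Rightarrow> 'e \<Rightarrow> bool" where
  "coparallel V ends e f \<longleftrightarrow> e \<noteq> f \<and> is_cut ends V UNIV {e, f} \<and>
     (\<forall>D. is_cut ends V UNIV D \<and> D \<subseteq> {e, f} \<longrightarrow> D = {e, f})"

definition coparallel_class :: "'v set \<Rightarrow> ('e \<Rightarrow> 'v set) \<Rightarrow> 'e set \<Rightarrow> bool" where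
  "coparallel_class V ends C \<longleftrightarrow>
     (\<forall>e\<in>C. \<not> is_bridge ends V UNIV e) \<and>
     (\<forall>e\<in>C. \<forall>f\<in>C. e \<noteq> f \<longrightarrow> coparallel V ends e f) \<and>
     (\<forall>C'. C \<subset> C' \<longrightarrow> \<not> ((\<forall>e\<in>C'. \<not> is_bridge ends V UNIV e) \<and>
                              (\<forall>e\<in>C'. \<forall>f\<in>C'. e \<noteq> f \<longrightarrow> coparallel V ends e f)))"

text \<open>Vertex sets of the connected components of (W, F).\<close>
definition components :: "('e \<Rightarrow> 'v set) \<Rightarrow> 'v set \<Rightarrow> 'e set \<Rightarrow> 'v set set" where
  "components ends W F = {{u\<in>W. (v, u) \<in> (adj ends F)\<^sup>*} | v. v \<in> W}"

text \<open>Edges of the component K of (W, F).\<close>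
definition comp_edges :: "('e \<Rightarrow> 'v set) \<Rightarrow> 'e set \<Rightarrow> 'v set \<Rightarrow> 'e set" where
  "comp_edges ends F K = {e\<in>F. ends e \<subseteq> K}"

end

theory Submission
  imports Defs
begin

text \<open>As 0 lies in the polytope but not on the face, it suffices that the tight vectors span
  all vectors of 2-edge-connected subgraphs. The main fact is that in a 2-edge-connected graph
  the subgraphs through a fixed edge already span: if H misses an edge e at one of its vertices,
  an ear of H through e expresses H by subgraphs containing e, and one moves from edge to edge
  by connectivity. The components of G - C are 2-edge-connected, so the fact applies inside each
  of them to the chosen edge. A subgraph containing f contains C and meets every component; it is
  G minus, for each component, the edges it misses there, and filling all components but one
  reduces this to the main fact in G.\<close>

section \<open>Cuts, walks and 2-edge-connectivity\<close>

locale loopless_multigraph =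
  fixes ends :: "'e::finite \<Rightarrow> 'v set"
  assumes card_ends: "card (ends e) = 2"
begin

lemma ends_obtain:
  obtains u v where "ends e = {u, v}" "u \<noteq> v"
  using card_ends[of e] by (auto simp: card_2_iff)

lemma in_delta_iff:
  assumes "ends e = {u, v}"
  shows "e \<in> delta ends F S \<longleftrightarrow> e \<in> F \<and> (u \<in> S) \<noteq> (v \<in> S)"
proof -
  have "u \<noteq> v" using card_ends[of e] assms by auto
  then show ?thesis using assms by (auto simp: delta_def Int_insert_left)
qed

text \<open>Cuts form a vector space over the two-element field. This is what allows 2-cuts to be
  added modulo 2 in the treatment of coparallel classes.\<close>

lemma delta_sym_diff:
  "delta ends F (sym_diff A B) = sym_diff (delta ends F A) (delta ends F B)"
proof (rule set_eqI)
  fix e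
  obtain u v where "ends e = {u, v}" by (rule ends_obtain)
  then show "e \<in> delta ends F (sym_diff A B) \<longleftrightarrow> e \<in> sym_diff (delta ends F A) (delta ends F B)"
    by (auto simp: in_delta_iff)
qed

lemma delta_Compl: "delta ends F (- S) = delta ends F S"
proof (rule set_eqI)
  fix e
  obtain u v where "ends e = {u, v}" by (rule ends_obtain)
  then show "e \<in> delta ends F (- S) \<longleftrightarrow> e \<in> delta ends F S"
    by (auto simp: in_delta_iff)
qed

lemma delta_Int_cong:
  assumes "\<forall>e\<in>F. ends e \<subseteq> W" "S \<inter> W = T \<inter> W"
  shows "delta ends F S = delta ends F T"
proof (rule set_eqI)
  fix e
  obtain u v where "ends e = {u, v}" by (rule ends_obtain)
  then show "e \<in> delta ends F S \<longleftrightarrow> e \<in> delta ends F T"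
    using assms by (auto simp: in_delta_iff)
qed

lemma delta_Un_edges: "delta ends (F \<union> F') S = delta ends F S \<union> delta ends F' S"
  by (auto simp: delta_def)

lemma delta_Diff_subset: "delta ends F (A - B) \<subseteq> delta ends F A \<union> delta ends F B"
proof
  fix e assume *: "e \<in> delta ends F (A - B)"
  obtain u v where "ends e = {u, v}" by (rule ends_obtain)
  with * show "e \<in> delta ends F A \<union> delta ends F B"
    by (auto simp: in_delta_iff)
qed

lemma delta_Un_subset: "delta ends F (A \<union> B) \<subseteq> delta ends F A \<union> delta ends F B"
proof
  fix e assume *: "e \<in> delta ends F (A \<union> B)"
  obtain u v where "ends e = {u, v}" by (rule ends_obtain)
  with * show "e \<in> delta ends F A \<union> delta ends F B"
    by (auto simp: in_delta_iff)
qed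

abbreviation linked :: "'e set \<Rightarrow> 'v \<Rightarrow> 'v \<Rightarrow> bool" where
  "linked F u v \<equiv> (u, v) \<in> (adj ends F)\<^sup>*"

lemma linked_edge: "e \<in> F \<Longrightarrow> ends e = {u, v} \<Longrightarrow> linked F u v"
  by (rule r_into_rtrancl) (auto simp: adj_def)

lemma linked_sym: "linked F u v \<Longrightarrow> linked F v u"
proof -
  have "sym (adj ends F)" by (auto simp: sym_def adj_def insert_commute)
  then show "linked F u v \<Longrightarrow> linked F v u" using sym_rtrancl symD by metis
qed

lemma linked_mono: "linked F u v \<Longrightarrow> F \<subseteq> F' \<Longrightarrow> linked F' u v"
proof -
  assume a: "linked F u v" "F \<subseteq> F'"
  then have "adj ends F \<subseteq> adj ends F'" by (auto simp: adj_def)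
  with a show ?thesis using rtrancl_mono by blast
qed

lemma linked_crosses:
  assumes "linked F u v" "u \<in> S" "v \<notin> S"
  shows "delta ends F S \<noteq> {}"
  using assms
proof (induction rule: rtrancl_induct)
  case (step y z)
  then obtain e where "e \<in> F" "ends e = {y, z}" by (auto simp: adj_def)
  with step show ?case by (cases "y \<in> S") (use in_delta_iff in blast)+
qed simp

lemma linked_crosses':
  assumes "linked F u v" "(u \<in> S) \<noteq> (v \<in> S)"
  shows "delta ends F S \<noteq> {}"
  using assms linked_crosses linked_sym by metis

lemma delta_reach: "delta ends F {v. linked F u v} = {}"
proof -
  have False if "e \<in> delta ends F {v. linked F u v}" for e
  proof -
    obtain a b where ab: "ends e = {a, b}" by (rule ends_obtain)
    then have "e \<in> F" "linked F u a \<noteq> linked F u b"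
      using that by (auto simp: in_delta_iff)
    with ab show False
      by (metis linked_edge linked_sym rtrancl_trans)
  qed
  then show ?thesis by blast
qed

text \<open>Connectedness and absence of bridges in a single condition on cuts: as \<open>b\<close>
  is arbitrary, the inclusion in \<open>{b}\<close> excludes both the cuts with no edge and those
  with one edge.\<close>

definition tec :: "'v set \<Rightarrow> 'e set \<Rightarrow> bool" where
  "tec W F \<longleftrightarrow> (\<forall>e\<in>F. ends e \<subseteq> W) \<and>
     (\<forall>S b. {} \<subset> S \<and> S \<subset> W \<longrightarrow> \<not> delta ends F S \<subseteq> {b})"

lemma tec_ends: "tec W F \<Longrightarrow> e \<in> F \<Longrightarrow> ends e \<subseteq> W"
  by (auto simp: tec_def)

text \<open>Here \<open>S\<close> may reach outside \<open>W\<close>, as reachability sets and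
  complements do. Edges of \<open>F\<close> end in \<open>W\<close>, so \<open>S\<close> and its
  trace on \<open>W\<close> have the same cut.\<close>

lemma tec_cut:
  assumes "tec W F" "x \<in> W \<inter> S" "y \<in> W - S"
  shows "\<not> delta ends F S \<subseteq> {b}"
proof -
  have "{} \<subset> S \<inter> W" "S \<inter> W \<subset> W" using assms by auto
  moreover have "delta ends F S = delta ends F (S \<inter> W)"
    by (rule delta_Int_cong[of F W]) (use assms in \<open>auto simp: tec_def\<close>)
  ultimately show ?thesis using assms(1) unfolding tec_def by metis
qed

text \<open>Only \<open>g\<close> can leave the set reachable from \<open>a\<close> without
  \<open>g\<close>, so this set has at most one cut edge in \<open>F\<close> and cannot separate
  \<open>b\<close> from \<open>a\<close>.\<close>

lemma tec_linked_remove: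
  assumes "tec W F" "a \<in> W" "b \<in> W"
  shows "linked (F - {g}) a b"
proof (rule ccontr)
  let ?S = "{v. linked (F - {g}) a v}"
  assume "\<not> linked (F - {g}) a b"
  then have "\<not> delta ends F ?S \<subseteq> {g}"
    using assms by (intro tec_cut[of W F a _ b]) auto
  moreover have "delta ends F ?S \<subseteq> insert g (delta ends (F - {g}) ?S)"
    by (auto simp: delta_def)
  ultimately show False by (simp add: delta_reach)
qed

lemma tec_linked: "tec W F \<Longrightarrow> a \<in> W \<Longrightarrow> b \<in> W \<Longrightarrow> linked F a b"
  by (rule linked_mono[OF tec_linked_remove]) auto

text \<open>Connectedness excludes empty cuts, and a nonempty cut inside \<open>{b}\<close> makes
  \<open>b\<close> a bridge.\<close>

lemma two_edge_connected_iff_tec: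
  assumes "\<forall>e\<in>F. ends e \<subseteq> W"
  shows "two_edge_connected ends W F \<longleftrightarrow> tec W F"
proof
  assume 2: "two_edge_connected ends W F"
  have "\<not> delta ends F S \<subseteq> {b}" if S: "{} \<subset> S \<and> S \<subset> W" for S b
  proof
    assume b: "delta ends F S \<subseteq> {b}"
    obtain x y where "x \<in> S" "y \<in> W - S" "x \<in> W" using S by blast
    moreover from this have "linked F x y"
      using 2 by (auto simp: two_edge_connected_def connected_graph_def)
    ultimately have "delta ends F S \<noteq> {}" using linked_crosses by blast
    with b have d: "delta ends F S = {b}" by blast
    then have "b \<in> F" by (auto simp: delta_def)
    with 2 d S show False
      unfolding two_edge_connected_def is_bridge_def is_cut_def by metis
  qed
  with assms show "tec W F" by (simp add: tec_def)
next
  assume t: "tec W F"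
  have "\<not> is_bridge ends W F e" for e
  proof
    assume "is_bridge ends W F e"
    then obtain S where "{} \<subset> S \<and> S \<subset> W" "{e} = delta ends F S"
      by (auto simp: is_bridge_def is_cut_def)
    then show False using t by (metis tec_def order_refl)
  qed
  then show "two_edge_connected ends W F"
    using tec_linked[OF t] by (simp add: two_edge_connected_def connected_graph_def)
qed

text \<open>A set with at most one cut edge contains all or none of \<open>W\<close>, and likewise
  of \<open>W'\<close>; a common vertex \<open>p\<close> forces the same choice for both.\<close>

lemma tec_Un:
  assumes "tec W F" "tec W' F'" "W \<inter> W' \<noteq> {}"
  shows "tec (W \<union> W') (F \<union> F')"
  unfolding tec_def
proof (intro conjI allI impI notI)
  show "\<forall>e\<in>F \<union> F'. ends e \<subseteq> W \<union> W'" using assms tec_ends by blast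
next
  fix S b assume S: "{} \<subset> S \<and> S \<subset> W \<union> W'" and d: "delta ends (F \<union> F') S \<subseteq> {b}"
  obtain p where p: "p \<in> W" "p \<in> W'" using assms by blast
  have "\<forall>x\<in>W. x \<in> S \<longleftrightarrow> p \<in> S"
    using tec_cut[OF assms(1), of _ S _ b] d p by (auto simp: delta_Un_edges)
  moreover have "\<forall>x\<in>W'. x \<in> S \<longleftrightarrow> p \<in> S"
    using tec_cut[OF assms(2), of _ S _ b] d p by (auto simp: delta_Un_edges)
  ultimately show False using S by blast
qed

section \<open>Minimal links and pairs of edge-disjoint links\<close>

definition min_link :: "'e set \<Rightarrow> 'v \<Rightarrow> 'v \<Rightarrow> bool" where
  "min_link J u v \<longleftrightarrow> linked J u v \<and> (\<forall>e\<in>J. \<not> linked (J - {e}) u v)"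

lemma ex_min_link:
  assumes "linked F u v"
  obtains J where "J \<subseteq> F" "min_link J u v"
proof -
  obtain J where J: "J \<subseteq> F" "linked J u v"
    "\<And>J'. J' \<subseteq> J \<Longrightarrow> linked J' u v \<Longrightarrow> J' = J"
    using finite_has_minimal2[of "{J. linked J u v}" F] assms by auto
  have "min_link J u v" unfolding min_link_def using J by blast
  with J that show ?thesis by blast
qed

text \<open>A minimal link is the edge set of a path, so having entered \<open>S\<close>, which
  avoids both ends, it must leave through another edge. The proof uses cuts alone: a single cut edge
  \<open>h\<close> would be bypassed by the union of \<open>S\<close> with the part reachable from
  \<open>u\<close> without \<open>h\<close>, and nothing would cross that union.\<close>

lemma min_link_cut:
  assumes J: "min_link J u v" and uv: "u \<notin> S" "v \<notin> S"
    and h: "h \<in> J" "ends h \<inter> S \<noteq> {}"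
  shows "\<not> delta ends J S \<subseteq> {b}"
proof
  assume b: "delta ends J S \<subseteq> {b}"
  \<comment> \<open>The new \<open>h\<close> is the cut edge if there is one, and otherwise the
    given edge; either way it meets \<open>S\<close> and bounds the cut of \<open>S\<close>.\<close>
  obtain h where h: "h \<in> J" "ends h \<inter> S \<noteq> {}" "delta ends J S \<subseteq> {h}"
  proof (cases "delta ends J S = {}")
    case True
    then show ?thesis using h that by blast
  next
    case False
    with b have d: "delta ends J S = {b}" by blast
    then have "b \<in> J" "card (ends b \<inter> S) = 1" by (auto simp: delta_def)
    then show ?thesis using d that by fastforce
  qed
  let ?R = "{x. linked (J - {h}) u x}"
  have R: "u \<in> ?R" "v \<notin> ?R" using J h by (auto simp: min_link_def)
  have "delta ends J ?R \<subseteq> insert h (delta ends (J - {h}) ?R)"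
    by (auto simp: delta_def)
  then have dR: "delta ends J ?R \<subseteq> {h}" by (simp add: delta_reach)
  have l: "linked J u v" using J by (simp add: min_link_def)
  have "delta ends J (?R - S) \<noteq> {}"
    by (rule linked_crosses[OF l]) (use R uv in auto)
  then have "h \<in> delta ends J (?R - S)" using dR h delta_Diff_subset by blast
  moreover obtain s t where st: "ends h = {s, t}" by (rule ends_obtain)
  \<comment> \<open>One end of \<open>h\<close> lies in \<open>?R - S\<close>, so the other is the
    one in \<open>S\<close>; both are in the union.\<close>
  ultimately have "h \<notin> delta ends J (?R \<union> S)" using h(2) by (auto simp: in_delta_iff)
  then have "delta ends J (?R \<union> S) = {}" using dR h delta_Un_subset by blast
  moreover have "delta ends J (?R \<union> S) \<noteq> {}"
    by (rule linked_crosses[OF l]) (use R uv in auto)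
  ultimately show False by simp
qed

text \<open>Two edge-disjoint paths with common ends form a closed trail. A set separating
  \<open>u\<close> from \<open>v\<close> is crossed by both of them; any other set is crossed twice
  by whichever path enters it.\<close>

lemma tec_disjoint_min_links:
  assumes J: "min_link J u v" "min_link J' u v" and disj: "J \<inter> J' = {}"
  shows "tec (\<Union>(ends ` (J \<union> J'))) (J \<union> J')"
  unfolding tec_def
proof (intro conjI allI impI notI)
  fix S b
  assume S: "{} \<subset> S \<and> S \<subset> \<Union>(ends ` (J \<union> J'))" and d: "delta ends (J \<union> J') S \<subseteq> {b}"
  show False
  proof (cases "u \<in> S \<longleftrightarrow> v \<in> S")
    case False
    then have "delta ends J S \<noteq> {}" "delta ends J' S \<noteq> {}"
      using J linked_crosses' by (auto simp: min_link_def)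
    then have "b \<in> delta ends J S" "b \<in> delta ends J' S" using d by (auto simp: delta_Un_edges)
    then show False using disj by (auto simp: delta_def)
  next
    case True
    \<comment> \<open>Passing to the complement keeps the cut and moves both ends outside, as
      \<open>min_link_cut\<close> requires.\<close>
    define T where "T = (if u \<in> S then - S else S)"
    have T: "u \<notin> T" "v \<notin> T" "delta ends (J \<union> J') T \<subseteq> {b}"
      using True d by (auto simp: T_def delta_Compl)
    have "\<exists>x\<in>\<Union>(ends ` (J \<union> J')). x \<in> T"
    proof (cases "u \<in> S")
      case True
      then show ?thesis using psubset_imp_ex_mem[OF conjunct2[OF S]] by (simp add: T_def) blast
    next
      case False
      then show ?thesis using S by (simp add: T_def) blast
    qed
    then obtain h where "h \<in> J \<union> J'" "ends h \<inter> T \<noteq> {}" by blast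
    then show False
      using min_link_cut[OF J(1) T(1,2), of h b] min_link_cut[OF J(2) T(1,2), of h b] T(3)
      by (auto simp: delta_Un_edges)
  qed
qed blast

text \<open>Otherwise the vertices not reachable from \<open>u\<close> would form a set that
  \<open>J\<close> enters but that has an empty cut.\<close>

lemma min_link_reach:
  assumes J: "min_link J u v" and h: "h \<in> J" "x \<in> ends h"
  shows "linked J u x"
proof (rule ccontr)
  assume n: "\<not> linked J u x"
  let ?S = "- {y. linked J u y}"
  have "\<not> delta ends J ?S \<subseteq> {h}"
    by (rule min_link_cut[OF J _ _ h(1)]) (use J n h in \<open>auto simp: min_link_def\<close>)
  then show False by (simp add: delta_Compl delta_reach)
qed

text \<open>Whitney's proof of Menger's theorem: the two links are carried along a walk leaving u.\<close>
lemma tec_two_disjoint_links: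
  assumes t: "tec W F" and "u \<in> W" "v \<in> W"
  obtains J J' where "J \<subseteq> F" "J' \<subseteq> F" "J \<inter> J' = {}" "min_link J u v" "min_link J' u v"
proof -
  have "linked F u v" using tec_linked assms by blast
  \<comment> \<open>Minimality is left out of the induction because the rerouted links need not be
    minimal. It is restored by \<open>ex_min_link\<close> in every step and at the end. At
    \<open>u\<close> itself two empty links serve.\<close>
  then have "\<exists>J J'. J \<subseteq> F \<and> J' \<subseteq> F \<and> J \<inter> J' = {} \<and> linked J u v \<and> linked J' u v"
  proof (induction rule: rtrancl_induct)
    case base
    then show ?case by (intro exI[of _ "{}"]) auto
  next
    case (step x y)
    obtain K K' where K: "K \<subseteq> F" "K' \<subseteq> F" "K \<inter> K' = {}" "linked K u x" "linked K' u x"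
      using step.IH by blast
    obtain J where J: "J \<subseteq> K" "min_link J u x" by (rule ex_min_link[OF K(4)])
    obtain J' where J': "J' \<subseteq> K'" "min_link J' u x" by (rule ex_min_link[OF K(5)])
    have F: "J \<subseteq> F" "J' \<subseteq> F" and disj: "J \<inter> J' = {}" using J J' K by auto
    have l: "linked J u x" "linked J' u x" using J J' by (auto simp: min_link_def)
    obtain g where g: "g \<in> F" "ends g = {x, y}" using step.hyps by (auto simp: adj_def)
    have yW: "y \<in> W" using tec_ends[OF t g(1)] g(2) by auto
    \<comment> \<open>A path to \<open>x\<close> that uses \<open>g\<close> passes through
      \<open>y\<close> before \<open>g\<close>: otherwise no edge of \<open>A\<close> would leave
      the part reachable without \<open>g\<close>.\<close>
    have shift: "linked (A - {g}) u y" if A: "min_link A u x" "g \<in> A" for A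
    proof (rule ccontr)
      let ?R = "{z. linked (A - {g}) u z}"
      assume "\<not> linked (A - {g}) u y"
      then have "g \<notin> delta ends A ?R" using A g by (auto simp: in_delta_iff min_link_def)
      then have "delta ends A ?R \<subseteq> delta ends (A - {g}) ?R" by (auto simp: delta_def)
      then have "delta ends A ?R = {}" by (simp add: delta_reach)
      moreover have "delta ends A ?R \<noteq> {}"
        by (rule linked_crosses[of u x]) (use A in \<open>auto simp: min_link_def\<close>)
      ultimately show False by simp
    qed
    have ext: "linked (insert g A) u y" if "linked A u x" for A
      using linked_mono[OF that, of "insert g A"] linked_edge[of g "insert g A" x y] g
      by (meson insertI1 rtrancl_trans subset_insertI)
    consider "g \<in> J" | "g \<in> J'" | "g \<notin> J" "g \<notin> J'" by blast
    then show ?case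
    proof cases
      case 1
      then show ?thesis using shift[OF J(2)] ext[OF l(2)] F disj g
        by (intro exI[of _ "J - {g}"] exI[of _ "insert g J'"]) auto
    next
      case 2
      then show ?thesis using shift[OF J'(2)] ext[OF l(1)] F disj g
        by (intro exI[of _ "insert g J"] exI[of _ "J' - {g}"]) auto
    next
      case 3
      \<comment> \<open>Walk from \<open>y\<close> back to \<open>u\<close> without \<open>g\<close>
        and stop at the first vertex \<open>p\<close> on one of the two links. That link is rerouted
        through \<open>?E\<close> to \<open>y\<close>, and the other is extended by
        \<open>g\<close>.\<close>
      let ?E = "F - {g} - J - J'"
      have "linked (F - {g}) y u" using tec_linked_remove[OF t yW assms(2)] .
      then have "\<exists>p. linked ?E y p \<and> (linked J u p \<or> linked J' u p)"
      proof (induction rule: converse_rtrancl_induct)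
        case base
        then show ?case by blast
      next
        case (step a b)
        obtain h where h: "h \<in> F - {g}" "ends h = {a, b}" using step.hyps by (auto simp: adj_def)
        show ?case
        proof (cases "h \<in> J \<union> J'")
          case True
          then show ?thesis using min_link_reach[OF J(2), of h a] min_link_reach[OF J'(2), of h a] h
            by blast
        next
          case False
          then have "linked ?E a b" using h by (intro linked_edge) auto
          then show ?thesis using step.IH by (meson rtrancl_trans)
        qed
      qed
      then obtain p where p: "linked ?E p y" "linked J u p \<or> linked J' u p"
        using linked_sym by blast
      have ext': "linked (A \<union> ?E) u y" if "linked A u p" for A
        using linked_mono[OF that, of "A \<union> ?E"] linked_mono[OF p(1), of "A \<union> ?E"]
        by (meson Un_upper1 Un_upper2 rtrancl_trans)
      from p(2) show ?thesis
      proof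
        assume "linked J u p"
        then show ?thesis using ext'[of J] ext[OF l(2)] F disj g 3
          by (intro exI[of _ "J \<union> ?E"] exI[of _ "insert g J'"]) auto
      next
        assume "linked J' u p"
        then show ?thesis using ext'[of J'] ext[OF l(1)] F disj g 3
          by (intro exI[of _ "insert g J"] exI[of _ "J' \<union> ?E"]) auto
      qed
    qed
  qed
  then obtain K K' where K: "K \<subseteq> F" "K' \<subseteq> F" "K \<inter> K' = {}" "linked K u v" "linked K' u v"
    by blast
  obtain J where J: "J \<subseteq> K" "min_link J u v" by (rule ex_min_link[OF K(4)])
  obtain J' where J': "J' \<subseteq> K'" "min_link J' u v" by (rule ex_min_link[OF K(5)])
  show ?thesis by (rule that[of J J']) (use J J' K in auto)
qed

section \<open>Subgraphs through a fixed edge span all subgraphs\<close>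

lemma incidence_vec_disjoint_Un:
  "A \<inter> B = {} \<Longrightarrow> incidence_vec (A \<union> B) = incidence_vec A + incidence_vec B"
  by (auto simp: incidence_vec_def vec_eq_iff)

definition tec_vecs :: "'v set \<Rightarrow> 'e set \<Rightarrow> 'e \<Rightarrow> (real ^ 'e) set" where
  "tec_vecs W0 F0 e = {incidence_vec F | W F. W \<subseteq> W0 \<and> F \<subseteq> F0 \<and> tec W F \<and> e \<in> F}"

lemma tec_vecsI:
  "tec W F \<Longrightarrow> e \<in> F \<Longrightarrow> W \<subseteq> W0 \<Longrightarrow> F \<subseteq> F0 \<Longrightarrow> incidence_vec F \<in> span (tec_vecs W0 F0 e)"
  unfolding tec_vecs_def by (rule span_base) blast

text \<open>An ear Q through e with ends w, v, closed up by either or both of two disjoint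
  w-v links in F, gives the vector of Q by inclusion-exclusion; adding F to the ear
  then isolates F.\<close>
lemma incident_edge_spans:
  assumes t0: "tec W0 F0" and e: "e \<in> F0"
    and t: "tec W F" and W: "W \<subseteq> W0" and F: "F \<subseteq> F0"
    and w: "w \<in> W" "w \<in> ends e"
  shows "incidence_vec F \<in> span (tec_vecs W0 F0 e)"
proof (cases "e \<in> F")
  case True
  then show ?thesis using tec_vecsI t W F by blast
next
  case eF: False
  obtain z where z: "ends e = {w, z}" "w \<noteq> z"
    using ends_obtain[of e] w by (metis insertE insert_commute singletonD)
  let ?E = "F0 - F - {e}"
  have Z0: "\<Union>(ends ` Z) \<subseteq> W0" if "Z \<subseteq> F0" for Z using that tec_ends[OF t0] by blast
  show ?thesis
  proof (cases "linked ?E z w")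
    case True
    \<comment> \<open>The ear returns to \<open>w\<close> itself: \<open>e\<close> and
      \<open>Q\<close> form a closed trail edge-disjoint from \<open>F\<close>, and adding
      \<open>F\<close> to it changes the vector by that of \<open>F\<close>.\<close>
    obtain Q where Q: "Q \<subseteq> ?E" "min_link Q z w" by (rule ex_min_link[OF True])
    have "min_link {e} z w"
      unfolding min_link_def using linked_edge[of e "{e}" z w] z
      by (auto simp: adj_def insert_commute)
    then have tZ: "tec (\<Union>(ends ` ({e} \<union> Q))) ({e} \<union> Q)"
      using tec_disjoint_min_links[of "{e}" z w Q] Q by blast
    then have tZF: "tec (\<Union>(ends ` ({e} \<union> Q)) \<union> W) (({e} \<union> Q) \<union> F)"
      using tec_Un[OF tZ t] w by blast
    have "incidence_vec (({e} \<union> Q) \<union> F) = incidence_vec ({e} \<union> Q) + incidence_vec F"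
      using eF Q by (intro incidence_vec_disjoint_Un) auto
    moreover have "incidence_vec ({e} \<union> Q) \<in> span (tec_vecs W0 F0 e)"
      by (rule tec_vecsI[OF tZ _ Z0]) (use e Q in auto)
    moreover have "incidence_vec (({e} \<union> Q) \<union> F) \<in> span (tec_vecs W0 F0 e)"
      by (rule tec_vecsI[OF tZF]) (use e Q F W Z0[of "{e} \<union> Q"] in auto)
    ultimately show ?thesis by (metis add_diff_cancel_left' span_diff)
  next
    case False
    have "linked (F0 - {e}) z w"
      using tec_linked_remove[OF t0] tec_ends[OF t0 e] z by blast
    \<comment> \<open>Stop the walk from \<open>z\<close> to \<open>w\<close> at its first vertex in
      \<open>W\<close>; up to there it uses no edge of \<open>F\<close>. This vertex is not
      \<open>w\<close>, by the case assumption.\<close>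
    then have "\<exists>v\<in>W. linked ?E z v"
    proof (induction rule: converse_rtrancl_induct)
      case base
      then show ?case using w by blast
    next
      case (step a b)
      then obtain h where h: "h \<in> F0 - {e}" "ends h = {a, b}" by (auto simp: adj_def)
      show ?case
      proof (cases "h \<in> F")
        case True
        then show ?thesis using tec_ends[OF t] h by blast
      next
        case False
        then have "linked ?E a b" using h by (intro linked_edge) auto
        then show ?thesis using step.IH by (meson rtrancl_trans)
      qed
    qed
    then obtain v where v: "v \<in> W" "linked ?E z v" by blast
    have wv: "w \<noteq> v" using v False by blast
    have "linked (insert e ?E) z v" using linked_mono[OF v(2)] by blast
    moreover have "linked (insert e ?E) w z" using linked_edge z by blast
    ultimately have "linked (insert e ?E) w v" by (meson rtrancl_trans)
    then obtain Q where Q: "Q \<subseteq> insert e ?E" "min_link Q w v" by (rule ex_min_link)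
    \<comment> \<open>A link from \<open>w\<close> to \<open>v\<close> without \<open>e\<close>
      would, together with the walk from \<open>z\<close> to \<open>v\<close>, join \<open>z\<close>
      to \<open>w\<close> inside \<open>?E\<close>.\<close>
    have eQ: "e \<in> Q"
    proof (rule ccontr)
      assume "e \<notin> Q"
      then have "linked ?E w v" using Q linked_mono by (metis min_link_def subset_insert)
      then show False using v False by (meson linked_sym rtrancl_trans)
    qed
    have QF: "Q \<inter> F = {}" using Q eF by blast
    have Q0: "Q \<subseteq> F0" using Q e by blast
    obtain J J' where J: "J \<subseteq> F" "J' \<subseteq> F" "J \<inter> J' = {}" "min_link J w v" "min_link J' w v"
      by (rule tec_two_disjoint_links[OF t w(1) v(1)])
    have tJ: "tec (\<Union>(ends ` (Q \<union> J))) (Q \<union> J)"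
      by (rule tec_disjoint_min_links[OF Q(2) J(4)]) (use QF J in auto)
    have tJ': "tec (\<Union>(ends ` (Q \<union> J'))) (Q \<union> J')"
      by (rule tec_disjoint_min_links[OF Q(2) J(5)]) (use QF J in auto)
    have tJJ: "tec (\<Union>(ends ` (Q \<union> J)) \<union> \<Union>(ends ` (Q \<union> J'))) ((Q \<union> J) \<union> (Q \<union> J'))"
      by (rule tec_Un[OF tJ tJ']) (use eQ z in blast)
    have tF: "tec (\<Union>(ends ` (Q \<union> J)) \<union> W) ((Q \<union> J) \<union> F)"
      by (rule tec_Un[OF tJ t]) (use eQ w in blast)
    let ?s = "span (tec_vecs W0 F0 e)"
    have s1: "incidence_vec (Q \<union> J) \<in> ?s"
      by (rule tec_vecsI[OF tJ _ Z0]) (use eQ Q0 J F in auto)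
    have s2: "incidence_vec (Q \<union> J') \<in> ?s"
      by (rule tec_vecsI[OF tJ' _ Z0]) (use eQ Q0 J F in auto)
    have s3: "incidence_vec ((Q \<union> J) \<union> (Q \<union> J')) \<in> ?s"
      by (rule tec_vecsI[OF tJJ]) (use eQ Q0 J F Z0[of "Q \<union> J"] Z0[of "Q \<union> J'"] in auto)
    have s4: "incidence_vec ((Q \<union> J) \<union> F) \<in> ?s"
      by (rule tec_vecsI[OF tF]) (use eQ Q0 J F W Z0[of "Q \<union> J"] in auto)
    have "incidence_vec F = incidence_vec ((Q \<union> J) \<union> F)
        - (incidence_vec (Q \<union> J) + incidence_vec (Q \<union> J') - incidence_vec ((Q \<union> J) \<union> (Q \<union> J')))"
      using QF J by (auto simp: incidence_vec_def vec_eq_iff)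
    then show ?thesis using s1 s2 s3 s4 by (metis span_add span_diff)
  qed
qed

text \<open>Induction along a walk from an end of \<open>e\<close> to a vertex of \<open>W\<close>.
  For a step along the edge \<open>g\<close> from \<open>x\<close> to \<open>y\<close>, subgraphs at
  \<open>y\<close> are spanned by those through \<open>g\<close>; these contain \<open>x\<close> and
  are covered by the induction hypothesis.\<close>

lemma tec_vecs_spanning:
  assumes t0: "tec W0 F0" and e: "e \<in> F0"
    and t: "tec W F" and W: "W \<subseteq> W0" and F: "F \<subseteq> F0"
  shows "incidence_vec F \<in> span (tec_vecs W0 F0 e)"
proof (cases "W = {}")
  case True
  then have "F = {}" using tec_ends[OF t] ends_obtain by (metis ex_in_conv insert_not_empty subset_empty)
  then have "incidence_vec F = (0 :: real ^ 'e)" by (simp add: incidence_vec_def vec_eq_iff)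
  then show ?thesis by (simp add: span_zero)
next
  case False
  then obtain w where w: "w \<in> W" by blast
  obtain a b where ab: "ends e = {a, b}" by (rule ends_obtain)
  have "linked F0 a w" using tec_linked[OF t0] tec_ends[OF t0 e] ab w W by blast
  then have "\<forall>W F. tec W F \<and> W \<subseteq> W0 \<and> F \<subseteq> F0 \<and> w \<in> W \<longrightarrow>
      incidence_vec F \<in> span (tec_vecs W0 F0 e)"
  proof (induction rule: rtrancl_induct)
    case base
    then show ?case using incident_edge_spans[OF t0 e] ab by blast
  next
    case (step x y)
    obtain g where g: "g \<in> F0" "ends g = {x, y}" using step.hyps by (auto simp: adj_def)
    have "tec_vecs W0 F0 g \<subseteq> span (tec_vecs W0 F0 e)"
    proof
      fix p assume "p \<in> tec_vecs W0 F0 g"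
      then obtain W F where "p = incidence_vec F" "W \<subseteq> W0" "F \<subseteq> F0" "tec W F" "g \<in> F"
        by (auto simp: tec_vecs_def)
      moreover from this have "x \<in> W" using tec_ends g by blast
      ultimately show "p \<in> span (tec_vecs W0 F0 e)" using step.IH by blast
    qed
    then have "span (tec_vecs W0 F0 g) \<subseteq> span (tec_vecs W0 F0 e)"
      using span_minimal subspace_span by blast
    then show ?case using incident_edge_spans[OF t0 g(1)] g(2) by blast
  qed
  then show ?thesis using t W F w by blast
qed

end

section \<open>Coparallel classes and the components of G - C\<close>

locale coparallel_split = loopless_multigraph ends
  for ends :: "'e::finite \<Rightarrow> 'v set" +
  fixes V :: "'v set" and C :: "'e set" and f :: 'e
  assumes tec_G: "tec V UNIV"
    and cclass: "coparallel_class V ends C"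
    and f_in_C: "f \<in> C"
begin

lemma ends_V: "ends e \<subseteq> V"
  using tec_ends[OF tec_G] by blast

lemma delta_not_singleton: "\<not> (b \<in> delta ends UNIV S \<and> delta ends UNIV S \<subseteq> {b})"
proof
  assume b: "b \<in> delta ends UNIV S \<and> delta ends UNIV S \<subseteq> {b}"
  obtain x y where xy: "ends b = {x, y}" by (rule ends_obtain)
  then have "(x \<in> S) \<noteq> (y \<in> S)" "x \<in> V" "y \<in> V"
    using b ends_V[of b] by (auto simp: in_delta_iff)
  then show False
    using tec_cut[OF tec_G, of x S y b] tec_cut[OF tec_G, of y S x b] b by blast
qed

text \<open>Removes the range condition on \<open>S\<close>, so that cuts can be combined by
  \<open>sym_diff\<close> freely. Connectedness of G makes cuts of proper nonempty sets nonempty,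
  and a cut edge has one end in \<open>V\<close> on each side.\<close>

lemma is_cut_iff: "is_cut ends V UNIV D \<longleftrightarrow> D \<noteq> {} \<and> (\<exists>S. D = delta ends UNIV S)"
proof
  assume "is_cut ends V UNIV D"
  then obtain S where S: "{} \<subset> S \<and> S \<subset> V" "D = delta ends UNIV S" by (auto simp: is_cut_def)
  have "D \<noteq> {}"
  proof
    assume "D = {}"
    then have "delta ends UNIV S \<subseteq> {f}" using S by blast
    then show False using tec_G S(1) unfolding tec_def by blast
  qed
  with S show "D \<noteq> {} \<and> (\<exists>S. D = delta ends UNIV S)" by blast
next
  assume "D \<noteq> {} \<and> (\<exists>S. D = delta ends UNIV S)"
  then obtain S b where S: "D = delta ends UNIV S" "b \<in> D" by blast
  obtain x y where xy: "ends b = {x, y}" by (rule ends_obtain)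
  then have "(x \<in> S) \<noteq> (y \<in> S)" "x \<in> V" "y \<in> V"
    using S ends_V[of b] by (auto simp: in_delta_iff)
  then have "{} \<subset> S \<inter> V \<and> S \<inter> V \<subset> V" by blast
  moreover have "delta ends UNIV S = delta ends UNIV (S \<inter> V)"
    by (rule delta_Int_cong[of _ V]) (use ends_V in auto)
  ultimately show "is_cut ends V UNIV D" unfolding is_cut_def using S by metis
qed

lemma not_bridge: "\<not> is_bridge ends V UNIV e"
proof
  assume "is_bridge ends V UNIV e"
  then obtain S where "{e} = delta ends UNIV S" by (auto simp: is_bridge_def is_cut_iff)
  then show False using delta_not_singleton[of e S] by blast
qed

text \<open>Minimality comes for free: in a 2-edge-connected graph no cut is empty or a single
  edge.\<close>

lemma coparallel_iff: "coparallel V ends b c \<longleftrightarrow> b \<noteq> c \<and> (\<exists>S. delta ends UNIV S = {b, c})"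
proof
  assume "coparallel V ends b c"
  then show "b \<noteq> c \<and> (\<exists>S. delta ends UNIV S = {b, c})"
    by (auto simp: coparallel_def is_cut_iff)
next
  assume bc: "b \<noteq> c \<and> (\<exists>S. delta ends UNIV S = {b, c})"
  have "D = {b, c}" if D: "is_cut ends V UNIV D" "D \<subseteq> {b, c}" for D
  proof -
    obtain S where S: "D = delta ends UNIV S" "D \<noteq> {}" using D by (auto simp: is_cut_iff)
    then show ?thesis
      using delta_not_singleton[of b S] delta_not_singleton[of c S] D by blast
  qed
  moreover have "is_cut ends V UNIV {b, c}" using bc by (auto simp: is_cut_iff)
  ultimately show "coparallel V ends b c" using bc by (simp add: coparallel_def)
qed

lemma coparallel_sym: "coparallel V ends b c \<Longrightarrow> coparallel V ends c b"
  by (auto simp: coparallel_iff insert_commute)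

text \<open>The 2-cuts \<open>{a, b}\<close> and \<open>{b, c}\<close> add up modulo 2 to
  \<open>{a, c}\<close>.\<close>

lemma coparallel_trans:
  assumes "coparallel V ends a b" "coparallel V ends b c" "a \<noteq> c"
  shows "coparallel V ends a c"
proof -
  obtain S T where "delta ends UNIV S = {a, b}" "delta ends UNIV T = {b, c}" "a \<noteq> b" "b \<noteq> c"
    using assms by (auto simp: coparallel_iff)
  then have "delta ends UNIV (sym_diff S T) = {a, c}"
    using assms(3) by (auto simp: delta_sym_diff)
  then show ?thesis using assms(3) coparallel_iff by blast
qed

lemma class_coparallel: "c \<in> C \<Longrightarrow> d \<in> C \<Longrightarrow> c \<noteq> d \<Longrightarrow> coparallel V ends c d"
  using cclass by (simp add: coparallel_class_def)

text \<open>By transitivity through \<open>f\<close>, the edge \<open>b\<close> is coparallel to all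
  of \<open>C\<close>, so a missing \<open>b\<close> could be added to the class.\<close>

lemma class_maximal:
  assumes "coparallel V ends b f"
  shows "b \<in> C"
proof (rule ccontr)
  assume b: "b \<notin> C"
  have bc: "coparallel V ends b c" if "c \<in> C" for c
    using that assms b coparallel_trans class_coparallel f_in_C by metis
  have "\<forall>e\<in>insert b C. \<forall>e'\<in>insert b C. e \<noteq> e' \<longrightarrow> coparallel V ends e e'"
    using bc coparallel_sym class_coparallel by auto
  moreover have "C \<subset> insert b C" using b by blast
  moreover have "\<not> (\<forall>e\<in>C'. \<forall>e'\<in>C'. e \<noteq> e' \<longrightarrow> coparallel V ends e e')" if "C \<subset> C'" for C'
    using cclass not_bridge that by (simp add: coparallel_class_def)
  ultimately show False by metis
qed

text \<open>If b were not in C, adding the 2-cuts {c, f} modulo 2 for the edges c of C in the cut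
  would leave {b}, a bridge, or {b, f}, against the maximality of C.\<close>
lemma cut_outside_class:
  assumes "delta ends UNIV S \<subseteq> insert b C" "b \<in> delta ends UNIV S"
  shows "b \<in> C"
proof (rule ccontr)
  assume b: "b \<notin> C"
  \<comment> \<open>Adding the cut \<open>{c, f}\<close> removes \<open>c\<close> and toggles
    \<open>f\<close>; hence both alternatives for \<open>f\<close> are carried through the
    induction.\<close>
  have red: "\<forall>S. delta ends UNIV S = insert b X \<or> delta ends UNIV S = insert b (insert f X) \<longrightarrow>
      (\<exists>S'. b \<in> delta ends UNIV S' \<and> delta ends UNIV S' \<subseteq> {b, f})"
    if "finite X" "X \<subseteq> C - {f}" for X
    using that
  proof (induction X rule: finite_induct)
    case empty
    then show ?case by blast
  next
    case (insert c X)
    show ?case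
    proof (intro allI impI)
      fix S
      assume S: "delta ends UNIV S = insert b (insert c X) \<or>
        delta ends UNIV S = insert b (insert f (insert c X))"
      obtain T where T: "delta ends UNIV T = {c, f}" "c \<noteq> f"
        using class_coparallel[of c f] insert.prems f_in_C by (auto simp: coparallel_iff)
      have "b \<noteq> c" "b \<noteq> f" "f \<notin> X" using b insert.prems f_in_C by auto
      then have "delta ends UNIV (sym_diff S T) = insert b (insert f X) \<or>
          delta ends UNIV (sym_diff S T) = insert b X"
        unfolding delta_sym_diff T using S insert.hyps T(2) by auto
      then show "\<exists>S'. b \<in> delta ends UNIV S' \<and> delta ends UNIV S' \<subseteq> {b, f}"
        using insert.IH insert.prems by blast
    qed
  qed
  let ?X = "delta ends UNIV S - {b, f}"
  have "delta ends UNIV S = insert b ?X \<or> delta ends UNIV S = insert b (insert f ?X)"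
    using assms(2) by blast
  moreover have "?X \<subseteq> C - {f}" using assms(1) by blast
  ultimately obtain S' where "b \<in> delta ends UNIV S'" "delta ends UNIV S' \<subseteq> {b, f}"
    using red[of ?X] finite by blast
  moreover from this have "delta ends UNIV S' = {b, f}" using delta_not_singleton[of b S'] by blast
  moreover have "b \<noteq> f" using b f_in_C by blast
  ultimately show False using class_maximal b coparallel_iff by blast
qed

abbreviation cedges :: "'v set \<Rightarrow> 'e set" where
  "cedges K \<equiv> comp_edges ends (UNIV - C) K"

abbreviation comps :: "'v set set" where
  "comps \<equiv> components ends V (UNIV - C)"

lemma compsE:
  assumes "K \<in> comps"
  obtains v where "v \<in> V" "K = {u \<in> V. linked (UNIV - C) v u}"
  using assms by (auto simp: components_def)

lemma comps_closed:
  assumes K: "K \<in> comps" and x: "x \<in> K" "x \<in> ends e" and e: "e \<notin> C"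
  shows "ends e \<subseteq> K"
proof -
  obtain v where v: "v \<in> V" "K = {u \<in> V. linked (UNIV - C) v u}" by (rule compsE[OF K])
  obtain y where y: "ends e = {x, y}" using ends_obtain[of e] x(2) by (metis insertE insert_commute singletonD)
  have "linked (UNIV - C) x y" using linked_edge y e by blast
  then have "linked (UNIV - C) v y" using v x by (auto intro: rtrancl_trans)
  then show ?thesis using v x y ends_V[of e] by auto
qed

lemma comps_eqI:
  assumes "K \<in> comps" "K' \<in> comps" "x \<in> K" "x \<in> K'"
  shows "K = K'"
proof -
  obtain v where v: "K = {u \<in> V. linked (UNIV - C) v u}" using compsE assms(1) by metis
  obtain w where w: "K' = {u \<in> V. linked (UNIV - C) w u}" using compsE assms(2) by metis
  have "linked (UNIV - C) v x" "linked (UNIV - C) w x" using assms v w by auto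
  then have "linked (UNIV - C) v w" "linked (UNIV - C) w v"
    by (meson linked_sym rtrancl_trans)+
  then show ?thesis unfolding v w by (auto intro: rtrancl_trans)
qed

lemma cedges_eqI:
  assumes "K \<in> comps" "K' \<in> comps" "e \<in> cedges K" "e \<in> cedges K'"
  shows "K = K'"
proof -
  obtain x y where "ends e = {x, y}" by (rule ends_obtain)
  then show ?thesis using comps_eqI[OF assms(1,2), of x] assms(3,4) by (auto simp: comp_edges_def)
qed

lemma tec_subset_comp:
  assumes t: "tec W F" "W \<subseteq> V" "F \<inter> C = {}" "w \<in> W"
  obtains K where "K \<in> comps" "W \<subseteq> K" "F \<subseteq> cedges K"
proof -
  let ?K = "{u \<in> V. linked (UNIV - C) w u}"
  have "W \<subseteq> ?K"
  proof
    fix x assume x: "x \<in> W"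
    then have "linked F w x" using tec_linked t by blast
    then have "linked (UNIV - C) w x" by (rule linked_mono) (use t in blast)
    then show "x \<in> ?K" using x t by blast
  qed
  moreover from this have "F \<subseteq> cedges ?K"
    using tec_ends[OF t(1)] t(3) unfolding comp_edges_def by blast
  moreover have "?K \<in> comps" using t by (auto simp: components_def)
  ultimately show ?thesis using that by blast
qed

lemma cedges_cover:
  assumes "e \<notin> C"
  obtains K where "K \<in> comps" "e \<in> cedges K"
proof -
  obtain x y where xy: "ends e = {x, y}" by (rule ends_obtain)
  let ?K = "{u \<in> V. linked (UNIV - C) x u}"
  have "x \<in> V" using xy ends_V by blast
  then have K: "?K \<in> comps" "x \<in> ?K" by (auto simp: components_def)
  then have "e \<in> cedges ?K" using comps_closed[OF K, of e] xy assms by (auto simp: comp_edges_def)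
  then show ?thesis using K that by blast
qed

text \<open>Edges outside \<open>C\<close> that cross a subset of \<open>K\<close> stay in
  \<open>K\<close>. If there were only one, \<open>b\<close>, the cut in G would consist of
  \<open>b\<close> and edges of \<open>C\<close>, against \<open>cut_outside_class\<close>; there is
  at least one because \<open>K\<close> is connected.\<close>

lemma tec_comp:
  assumes K: "K \<in> comps"
  shows "tec K (cedges K)"
  unfolding tec_def
proof (intro conjI allI impI notI)
  show "\<forall>e\<in>cedges K. ends e \<subseteq> K" by (simp add: comp_edges_def)
next
  fix S b
  assume S: "{} \<subset> S \<and> S \<subset> K" and d: "delta ends (cedges K) S \<subseteq> {b}"
  obtain v where v: "v \<in> V" "K = {u \<in> V. linked (UNIV - C) v u}" by (rule compsE[OF K])
  obtain x y where xy: "x \<in> S" "y \<in> K" "y \<notin> S" "x \<in> K" using S by blast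
  have "linked (UNIV - C) x y" using v xy by (auto intro: rtrancl_trans linked_sym)
  then have ne: "delta ends (UNIV - C) S \<noteq> {}" using linked_crosses xy by blast
  have "delta ends (UNIV - C) S \<subseteq> delta ends (cedges K) S"
  proof
    fix e assume e: "e \<in> delta ends (UNIV - C) S"
    obtain p q where pq: "ends e = {p, q}" by (rule ends_obtain)
    have "e \<notin> C" using e by (simp add: delta_def)
    moreover have "p \<in> K \<or> q \<in> K" using e pq S by (auto simp: in_delta_iff)
    ultimately have "ends e \<subseteq> K" using comps_closed[OF K] pq by blast
    then show "e \<in> delta ends (cedges K) S" using e by (auto simp: delta_def comp_edges_def)
  qed
  then have "delta ends (UNIV - C) S = {b}" using d ne by blast
  then have b: "b \<notin> C" "b \<in> delta ends UNIV S" "delta ends UNIV S \<subseteq> insert b C"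
    by (auto simp: delta_def)
  then show False using cut_outside_class by blast
qed

text \<open>If \<open>d\<close> were missing, the 2-cut \<open>{c, d}\<close> would meet
  \<open>F\<close> in \<open>c\<close> alone and make \<open>c\<close> a bridge of the
  subgraph.\<close>

lemma class_all_or_none:
  assumes t: "tec W F" and c: "c \<in> C" "c \<in> F" and d: "d \<in> C"
  shows "d \<in> F"
proof (rule ccontr)
  assume dF: "d \<notin> F"
  then obtain S where S: "delta ends UNIV S = {c, d}"
    using class_coparallel[OF c(1) d] c by (auto simp: coparallel_iff)
  have sub: "delta ends F S \<subseteq> {c}"
  proof
    fix e assume "e \<in> delta ends F S"
    then have "e \<in> delta ends UNIV S" "e \<in> F" by (auto simp: delta_def)
    then show "e \<in> {c}" using S dF by blast
  qed
  obtain x y where xy: "ends c = {x, y}" by (rule ends_obtain)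
  have "c \<in> delta ends UNIV S" using S by blast
  then have "(x \<in> S) \<noteq> (y \<in> S)" using in_delta_iff[OF xy] by blast
  moreover have "x \<in> W" "y \<in> W" using tec_ends[OF t c(2)] xy by auto
  ultimately show False using tec_cut[OF t, of x S y c] tec_cut[OF t, of y S x c] sub by blast
qed

text \<open>If \<open>K\<close> misses an end of \<open>f\<close>, then some edge of the connected
  graph G leaves \<open>K\<close>. It belongs to \<open>C\<close>, hence to \<open>F\<close>, and
  its end in \<open>K\<close> lies in \<open>W\<close>.\<close>

lemma class_meets_comps:
  assumes t: "tec W F" and C: "C \<subseteq> F" and K: "K \<in> comps"
  shows "W \<inter> K \<noteq> {}"
proof -
  obtain v where v: "v \<in> V" "K = {u \<in> V. linked (UNIV - C) v u}" by (rule compsE[OF K])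
  obtain x y where xy: "ends f = {x, y}" by (rule ends_obtain)
  have xW: "x \<in> W" using tec_ends[OF t, of f] C f_in_C xy by blast
  show ?thesis
  proof (cases "x \<in> K")
    case True
    then show ?thesis using xW by blast
  next
    case False
    have "linked UNIV v x" using tec_linked[OF tec_G v(1)] ends_V[of f] xy by blast
    then obtain e where e: "e \<in> delta ends UNIV K"
      using linked_crosses[of v x UNIV K] False v by blast
    obtain p q where pq: "ends e = {p, q}" by (rule ends_obtain)
    have pqK: "(p \<in> K) \<noteq> (q \<in> K)" using e pq by (auto simp: in_delta_iff)
    then have "e \<in> C" using comps_closed[OF K, of _ e] pq by blast
    then have "ends e \<subseteq> W" using tec_ends[OF t] C by blast
    then show ?thesis using pqK pq by blast
  qed
qed

end

section \<open>Validity of the inequality and the span of its tight vectors\<close>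

locale coparallel_inequality = coparallel_split ends V C f
  for ends :: "'e::finite \<Rightarrow> 'v set" and V C f +
  fixes ee :: "'v set \<Rightarrow> 'e" and Ks :: "'v set set"
  assumes finite_V: "finite V"
    and Ks_def: "Ks = {K \<in> comps. cedges K \<noteq> {}}"
    and ee: "K \<in> Ks \<Longrightarrow> ee K \<in> cedges K"
begin

lemma KsD: "K \<in> Ks \<Longrightarrow> K \<in> comps"
  by (simp add: Ks_def)

lemma Ks_subset: "K \<in> Ks \<Longrightarrow> K \<subseteq> V"
  using compsE[of K] by (auto simp: Ks_def)

lemma finite_Ks: "finite Ks"
proof (rule finite_subset)
  show "Ks \<subseteq> Pow V" using Ks_subset by blast
qed (simp add: finite_V)

text \<open>The subtraction takes place in the reals: when \<open>C\<close> contains every edge,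
  \<open>Ks\<close> is empty and the form is just the \<open>f\<close>-coordinate.\<close>

definition lhs :: "real ^ 'e \<Rightarrow> real" where
  "lhs x = (\<Sum>K\<in>Ks. x $ ee K) - (real (card Ks) - 1) * x $ f"

lemma lhs_ring:
  assumes "f \<in> F" "\<forall>K\<in>Ks. ee K \<in> F"
  shows "lhs (incidence_vec F) = 1"
proof -
  have "(\<Sum>K\<in>Ks. (incidence_vec F :: real ^ 'e) $ ee K) = (\<Sum>K\<in>Ks. 1)"
    by (rule sum.cong) (use assms in \<open>auto simp: incidence_vec_def\<close>)
  then show ?thesis using assms by (simp add: lhs_def incidence_vec_def)
qed

lemma lhs_comp:
  assumes K: "K \<in> Ks" and F: "F \<subseteq> cedges K"
  shows "lhs (incidence_vec F) = (if ee K \<in> F then 1 else 0)"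
proof -
  have "f \<notin> F" using F f_in_C by (auto simp: comp_edges_def)
  moreover have "(\<Sum>K'\<in>Ks. (incidence_vec F :: real ^ 'e) $ ee K')
      = (\<Sum>K'\<in>Ks. if K' = K then (if ee K \<in> F then 1 else 0) else 0)"
  proof (rule sum.cong)
    fix K' assume K': "K' \<in> Ks"
    have "K' = K" if "ee K' \<in> F" using cedges_eqI[of K' K "ee K'"] that F ee K K' KsD by blast
    then show "(incidence_vec F :: real ^ 'e) $ ee K' = (if K' = K then (if ee K \<in> F then 1 else 0) else 0)"
      by (auto simp: incidence_vec_def)
  qed simp
  ultimately show ?thesis using K finite_Ks by (simp add: lhs_def incidence_vec_def)
qed

text \<open>Missing \<open>f\<close> means missing all of \<open>C\<close>, so the subgraph is
  connected within G - C; the edge \<open>e\<close> puts its component into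
  \<open>Ks\<close>.\<close>

lemma tec_avoiding_f:
  assumes t: "tec W F" "W \<subseteq> V" and f: "f \<notin> F" and e: "e \<in> F"
  obtains K where "K \<in> Ks" "W \<subseteq> K" "F \<subseteq> cedges K"
proof -
  have "F \<inter> C = {}" using class_all_or_none[OF t(1)] f f_in_C by blast
  moreover obtain w where "w \<in> W" using tec_ends[OF t(1) e] ends_obtain[of e] by blast
  ultimately obtain K where "K \<in> comps" "W \<subseteq> K" "F \<subseteq> cedges K" using tec_subset_comp t by metis
  with e that show ?thesis by (auto simp: Ks_def)
qed

text \<open>With \<open>f\<close>, at most r - (r - 1) is reached; without \<open>f\<close>, a
  single component contributes at most one chosen edge.\<close>

lemma lhs_le_1:
  assumes t: "tec W F" "W \<subseteq> V"
  shows "lhs (incidence_vec F) \<le> 1"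
proof -
  consider "f \<in> F" | "F = {}" | e where "f \<notin> F" "e \<in> F" by blast
  then show ?thesis
  proof cases
    case 1
    have "(\<Sum>K\<in>Ks. (incidence_vec F :: real ^ 'e) $ ee K) \<le> (\<Sum>K\<in>Ks. 1)"
      by (rule sum_mono) (auto simp: incidence_vec_def)
    then show ?thesis using 1 by (simp add: lhs_def incidence_vec_def)
  next
    case 2
    then show ?thesis by (simp add: lhs_def incidence_vec_def)
  next
    case 3
    obtain K where "K \<in> Ks" "F \<subseteq> cedges K" by (rule tec_avoiding_f[OF t 3])
    then show ?thesis by (simp add: lhs_comp)
  qed
qed

definition tight :: "(real ^ 'e) set" where
  "tight = {incidence_vec F | W F. W \<subseteq> V \<and> tec W F \<and> lhs (incidence_vec F) = 1}"

lemma tightI: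
  "tec W F \<Longrightarrow> W \<subseteq> V \<Longrightarrow> lhs (incidence_vec F) = 1 \<Longrightarrow> incidence_vec F \<in> tight"
  unfolding tight_def by blast

lemma UNIV_tight: "incidence_vec UNIV \<in> tight"
  by (rule tightI[OF tec_G]) (simp_all add: lhs_ring)

lemma comp_in_span:
  assumes K: "K \<in> Ks" and t: "tec W F" "W \<subseteq> K" "F \<subseteq> cedges K"
  shows "incidence_vec F \<in> span tight"
proof -
  have "tec_vecs K (cedges K) (ee K) \<subseteq> tight"
  proof
    fix p assume "p \<in> tec_vecs K (cedges K) (ee K)"
    then obtain W F where "p = incidence_vec F" "W \<subseteq> K" "F \<subseteq> cedges K" "tec W F" "ee K \<in> F"
      by (auto simp: tec_vecs_def)
    then show "p \<in> tight" using tightI[of W F] lhs_comp[OF K, of F] Ks_subset[OF K] by simp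
  qed
  then show ?thesis
    using tec_vecs_spanning[OF tec_comp[OF KsD[OF K]] ee[OF K] t] span_mono by blast
qed

text \<open>As \<open>C\<close> lies in \<open>F\<close>, every component shares a vertex with
  \<open>W\<close>, so \<open>tec_Un\<close> adds them one at a time.\<close>

lemma tec_Un_comps:
  assumes t: "tec W F" and C: "C \<subseteq> F" and A: "A \<subseteq> Ks"
  shows "tec (W \<union> \<Union>A) (F \<union> \<Union>(cedges ` A))"
  using finite_subset[OF A finite_Ks] A
proof (induction A rule: finite_induct)
  case empty
  then show ?case using t by simp
next
  case (insert K A)
  have "tec ((W \<union> \<Union>A) \<union> K) ((F \<union> \<Union>(cedges ` A)) \<union> cedges K)"
  proof (rule tec_Un)
    show "tec (W \<union> \<Union>A) (F \<union> \<Union>(cedges ` A))" using insert.IH insert.prems by simp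
    have K: "K \<in> comps" using KsD insert.prems by simp
    then show "tec K (cedges K)" by (rule tec_comp)
    show "(W \<union> \<Union>A) \<inter> K \<noteq> {}" using class_meets_comps[OF t C K] by blast
  qed
  moreover have "(W \<union> \<Union>A) \<union> K = W \<union> \<Union>(insert K A)" by blast
  moreover have "(F \<union> \<Union>(cedges ` A)) \<union> cedges K = F \<union> \<Union>(cedges ` insert K A)" by blast
  ultimately show ?case by simp
qed

text \<open>F is filled up in all components except K. The linear map phi copies the f-coordinate
  into the other components; it fixes the filled vector and sends vectors of 2-edge-connected
  subgraphs through ee K to tight ones.\<close>
lemma filled_in_span:
  assumes t: "tec W F" "W \<subseteq> V" and f: "f \<in> F" and K: "K \<in> Ks"
  shows "incidence_vec (F \<union> \<Union>(cedges ` (Ks - {K}))) \<in> span tight"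
proof -
  let ?N = "\<Union>(cedges ` (Ks - {K}))"
  define phi :: "real ^ 'e \<Rightarrow> real ^ 'e" where "phi x = (\<chi> i. if i \<in> ?N then x $ f else x $ i)" for x
  have lin: "linear phi"
    by (rule linearI) (auto simp: phi_def vec_eq_iff)
  have KN: "cedges K \<inter> ?N = {}" using cedges_eqI KsD K by blast
  have fN: "f \<notin> ?N" using f_in_C by (auto simp: comp_edges_def)
  have in_V: "W' \<union> \<Union>(Ks - {K}) \<subseteq> V" if "W' \<subseteq> V" for W' using that Ks_subset by blast
  have tN: "tec (W' \<union> \<Union>(Ks - {K})) (F' \<union> ?N)" if "tec W' F'" "f \<in> F'" for W' F'
    using tec_Un_comps[OF that(1), of "Ks - {K}"] class_all_or_none[OF that(1) f_in_C that(2)] by blast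
  have sub: "phi ` tec_vecs V UNIV (ee K) \<subseteq> span tight"
  proof
    fix p assume "p \<in> phi ` tec_vecs V UNIV (ee K)"
    then obtain W' F' where F': "p = phi (incidence_vec F')" "W' \<subseteq> V" "tec W' F'" "ee K \<in> F'"
      by (auto simp: tec_vecs_def)
    show "p \<in> span tight"
    proof (cases "f \<in> F'")
      case True
      have "p = incidence_vec (F' \<union> ?N)"
        using F' True by (auto simp: phi_def incidence_vec_def vec_eq_iff)
      moreover have "ee K' \<in> F' \<union> ?N" if "K' \<in> Ks" for K'
        using F'(4) ee[OF that] that by (cases "K' = K") auto
      then have "lhs (incidence_vec (F' \<union> ?N)) = 1" using True by (intro lhs_ring) auto
      ultimately show ?thesis using span_base[OF tightI[OF tN[OF F'(3) True] in_V]] F'(2) by simp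
    \<comment> \<open>Without \<open>f\<close>, the subgraph lies in one component, which is
      \<open>K\<close> because of \<open>ee K\<close>. It has no edge in \<open>?N\<close>, and its
      \<open>f\<close>-coordinate is 0, so \<open>phi\<close> fixes its vector.\<close>
    next
      case False
      obtain K' where K': "K' \<in> Ks" "W' \<subseteq> K'" "F' \<subseteq> cedges K'"
        by (rule tec_avoiding_f[OF F'(3,2) False F'(4)])
      have "K' = K" using cedges_eqI[of K' K "ee K"] K' K F'(4) ee[OF K] KsD by blast
      then have F'K: "F' \<subseteq> cedges K" "W' \<subseteq> K" using K' by auto
      then have "F' \<inter> ?N = {}" using KN by blast
      then have "p = incidence_vec F'"
        using F'(1) False by (auto simp: phi_def incidence_vec_def vec_eq_iff)
      then show ?thesis using comp_in_span[OF K F'(3)] F'K by simp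
    qed
  qed
  let ?M = "F \<union> ?N"
  have "incidence_vec ?M \<in> span (tec_vecs V UNIV (ee K))"
    by (rule tec_vecs_spanning[OF tec_G _ tN[OF t(1) f] in_V[OF t(2)]]) auto
  then have "phi (incidence_vec ?M) \<in> span (phi ` tec_vecs V UNIV (ee K))"
    by (simp add: linear_span_image[OF lin])
  moreover have "phi (incidence_vec ?M) = incidence_vec ?M"
    using f by (auto simp: phi_def incidence_vec_def vec_eq_iff)
  moreover have "span (phi ` tec_vecs V UNIV (ee K)) \<subseteq> span tight"
    using sub by (simp add: span_minimal)
  ultimately show ?thesis by auto
qed

lemma in_span_tight:
  assumes t: "tec W F" "W \<subseteq> V"
  shows "incidence_vec F \<in> span tight"
proof -
  consider "f \<in> F" | "F = {}" | e where "f \<notin> F" "e \<in> F" by blast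
  then show ?thesis
  proof cases
    case 1
    have C: "C \<subseteq> F" using class_all_or_none[OF t(1) f_in_C 1] by blast
    have U: "incidence_vec UNIV \<in> span tight" using UNIV_tight by (rule span_base)
    \<comment> \<open>This is what G has beyond \<open>F\<close> filled up outside \<open>K\<close>,
      hence a difference of two vectors in the span.\<close>
    have "incidence_vec (cedges K - F) \<in> span tight" if K: "K \<in> Ks" for K
    proof -
      let ?M = "F \<union> \<Union>(cedges ` (Ks - {K}))"
      have un: "UNIV = ?M \<union> (cedges K - F)"
      proof -
        have "i \<in> ?M \<union> (cedges K - F)" for i
        proof (cases "i \<in> C")
          case True
          then show ?thesis using C by blast
        next
          case False
          obtain K' where "K' \<in> comps" "i \<in> cedges K'" by (rule cedges_cover[OF False])
          then show ?thesis by (cases "K' = K") (auto simp: Ks_def)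
        qed
        then show ?thesis by blast
      qed
      have "?M \<inter> (cedges K - F) = {}" using cedges_eqI KsD K by blast
      then have "incidence_vec UNIV = incidence_vec ?M + (incidence_vec (cedges K - F) :: real ^ 'e)"
        using incidence_vec_disjoint_Un un by metis
      then show ?thesis
        using U filled_in_span[OF t 1 K] by (metis add_diff_cancel_left' span_diff)
    qed
    \<comment> \<open>An edge missed by \<open>F\<close> is outside \<open>C\<close>, so it lies in
      exactly one component and is subtracted exactly once.\<close>
    moreover have "incidence_vec F = incidence_vec UNIV - (\<Sum>K\<in>Ks. incidence_vec (cedges K - F) :: real ^ 'e)"
    proof (subst vec_eq_iff, rule allI)
      fix i
      have "(\<Sum>K\<in>Ks. (incidence_vec (cedges K - F) :: real ^ 'e) $ i) = (if i \<in> F then 0 else 1)"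
      proof (cases "i \<in> F")
        case True
        then show ?thesis by (simp add: incidence_vec_def)
      next
        case False
        then have "i \<notin> C" using C by blast
        then obtain K where K: "K \<in> comps" "i \<in> cedges K" by (rule cedges_cover)
        then have "K \<in> Ks" by (auto simp: Ks_def)
        have "(\<Sum>K'\<in>Ks. (incidence_vec (cedges K' - F) :: real ^ 'e) $ i)
            = (\<Sum>K'\<in>Ks. if K' = K then 1 else 0)"
        proof (rule sum.cong)
          fix K' assume "K' \<in> Ks"
          then have "i \<in> cedges K' \<longleftrightarrow> K' = K" using cedges_eqI[OF _ K(1) _ K(2)] K KsD by blast
          then show "(incidence_vec (cedges K' - F) :: real ^ 'e) $ i = (if K' = K then 1 else 0)"
            using False by (simp add: incidence_vec_def)
        qed simp
        then show ?thesis using False \<open>K \<in> Ks\<close> finite_Ks by simp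
      qed
      then show "(incidence_vec F :: real ^ 'e) $ i
          = (incidence_vec UNIV - (\<Sum>K\<in>Ks. incidence_vec (cedges K - F))) $ i"
        by (simp add: incidence_vec_def)
    qed
    ultimately show ?thesis using U by (simp add: span_diff span_sum)
  next
    case 2
    then have "incidence_vec F = (0 :: real ^ 'e)" by (simp add: incidence_vec_def vec_eq_iff)
    then show ?thesis by (simp add: span_zero)
  next
    case 3
    obtain K where "K \<in> Ks" "W \<subseteq> K" "F \<subseteq> cedges K" by (rule tec_avoiding_f[OF t 3])
    then show ?thesis using comp_in_span t by blast
  qed
qed

section \<open>From the span of the tight vectors to the facet\<close>

lemma TECSP_eq: "TECSP V ends = convex hull {incidence_vec F | W F. W \<subseteq> V \<and> tec W F}"
proof -
  have "is_subgraph V ends W F \<and> two_edge_connected ends W F \<longleftrightarrow> W \<subseteq> V \<and> tec W F" for W :: "'v set" and F :: "'e set"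
  proof (cases "\<forall>e\<in>F. ends e \<subseteq> W")
    case True
    then show ?thesis by (simp add: is_subgraph_def two_edge_connected_iff_tec)
  next
    case False
    then have "\<not> tec W F" using tec_ends by blast
    with False show ?thesis by (simp add: is_subgraph_def)
  qed
  then show ?thesis by (simp add: TECSP_def)
qed

lemma lhs_inner: "\<exists>a. \<forall>x. lhs x = a \<bullet> x"
proof (intro exI allI)
  fix x :: "real ^ 'e"
  show "lhs x = ((\<Sum>K\<in>Ks. axis (ee K) 1) - (real (card Ks) - 1) *\<^sub>R axis f 1) \<bullet> x"
    by (simp add: lhs_def inner_diff_left inner_sum_left inner_axis')
qed

lemma lhs_facet:
  shows "\<forall>x\<in>TECSP V ends. lhs x \<le> 1"
    and "{x \<in> TECSP V ends. lhs x = 1} facet_of TECSP V ends"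
proof -
  let ?P = "TECSP V ends"
  let ?gen = "{incidence_vec F :: real ^ 'e | W F. W \<subseteq> V \<and> tec W F}"
  let ?face = "{x \<in> ?P. lhs x = 1}"
  obtain a where a: "\<And>x. lhs x = a \<bullet> x" using lhs_inner by blast
  have gen: "?gen \<subseteq> ?P" unfolding TECSP_eq by (rule hull_subset)
  have "?P \<subseteq> {x. a \<bullet> x \<le> 1}"
    unfolding TECSP_eq
    by (rule hull_minimal) (use lhs_le_1 a in \<open>auto simp: convex_halfspace_le\<close>)
  then show le: "\<forall>x\<in>?P. lhs x \<le> 1" by (auto simp: a)
  have conv: "convex ?P" by (simp add: TECSP_eq)
  have "(?P \<inter> {x. a \<bullet> x = 1}) face_of ?P"
    by (rule face_of_Int_supporting_hyperplane_le[OF conv]) (use le a in auto)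
  moreover have "?P \<inter> {x. a \<bullet> x = 1} = ?face" by (auto simp: a)
  ultimately have face: "?face face_of ?P" by simp
  have tight: "tight \<subseteq> ?face" using gen by (auto simp: tight_def)
  have "tec {} {}" by (simp add: tec_def)
  then have "incidence_vec {} \<in> ?P" using gen by blast
  moreover have "incidence_vec {} = (0 :: real ^ 'e)" by (simp add: incidence_vec_def vec_eq_iff)
  ultimately have P0: "0 \<in> ?P" by simp
  have F0: "0 \<notin> ?face" by (simp add: a)
  \<comment> \<open>The face is proper, since the origin lies in the polytope but not on the
    face.\<close>
  have "aff_dim ?face < aff_dim ?P"
    using face_of_aff_dim_lt[OF conv face] P0 F0 by blast
  \<comment> \<open>The polytope lies in the span of the face, which is the affine hull of the face
    together with 0. One extra point raises the affine dimension by at most one.\<close>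
  moreover have "aff_dim ?P \<le> aff_dim ?face + 1"
  proof -
    have "?gen \<subseteq> span tight" using in_span_tight by blast
    then have "?P \<subseteq> span tight"
      unfolding TECSP_eq by (rule hull_minimal) (simp add: subspace_imp_convex)
    also have "\<dots> \<subseteq> span (insert 0 ?face)" using tight by (intro span_mono) blast
    also have "\<dots> = affine hull (insert 0 ?face)"
      by (rule affine_hull_span_0[symmetric]) (simp add: hull_inc)
    finally have "aff_dim ?P \<le> aff_dim (insert 0 ?face)"
      by (metis aff_dim_affine_hull aff_dim_subset)
    then show ?thesis by (simp add: aff_dim_insert split: if_splits)
  qed
  ultimately have "aff_dim ?face = aff_dim ?P - 1" by linarith
  \<comment> \<open>A facet has to be nonempty as well; the vector of G itself is tight.\<close>
  then show "?face facet_of ?P"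
    unfolding facet_of_def using face UNIV_tight tight by blast
qed

end

theorem mainTheorem10:
  fixes V :: "'v set" and ends :: "'e::finite \<Rightarrow> 'v set"
    and C :: "'e set" and f :: 'e and ee :: "'v set \<Rightarrow> 'e"
  assumes "simple_graph V ends"
    and "two_edge_connected ends V UNIV"
    and "coparallel_class V ends C"
    and "f \<in> C"
  defines "Ks \<equiv> {K \<in> components ends V (UNIV - C). comp_edges ends (UNIV - C) K \<noteq> {}}"
  assumes "\<forall>K\<in>Ks. ee K \<in> comp_edges ends (UNIV - C) K"
  shows "(\<forall>x\<in>TECSP V ends. (\<Sum>K\<in>Ks. x $ ee K) - (real (card Ks) - 1) * x $ f \<le> 1)
       \<and> {x \<in> TECSP V ends. (\<Sum>K\<in>Ks. x $ ee K) - (real (card Ks) - 1) * x $ f = 1}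
           facet_of TECSP V ends"
proof -
  interpret loopless_multigraph ends
    by unfold_locales (use assms(1) in \<open>simp add: simple_graph_def\<close>)
  have "tec V UNIV"
    using assms(1,2) two_edge_connected_iff_tec[of UNIV V] by (simp add: simple_graph_def)
  then interpret coparallel_inequality ends V C f ee Ks
    by unfold_locales (use assms in \<open>auto simp: simple_graph_def\<close>)
  show ?thesis using lhs_facet by (simp add: lhs_def)
qed

end
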